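(* Let $\lambda_{k*}=(\lambda_{k\ell})_{\ell\in[L]}$ and $\lambda_{r*}=(\lambda_{r\ell})_{\ell\in[L]}$ be vectors with positive entries, $\mathbb Q_k=\prod_{\ell=1}^L\mathrm{Poi}(\lambda_{k\ell})$ and $\mathbb Q_r=\prod_{\ell=1}^L\mathrm{Poi}(\lambda_{r\ell})$, and let $\Lambda=[\lambda_{k*};\lambda_{r*}]\in\mathbb R_+^{2\times L}$. Consider the likelihood ratio test of the null hypothesis $\mathbb Q_k$ against $\mathbb Q_r$ based on a sample of size $1$. Assume that, as $\Lambda_{\min}\to\infty$, (a) $\liminf\varepsilon_{kr}>0$, and (b) $\omega=O(1)$, where $\|\Lambda\|_\infty/\Lambda_{\min}\le\omega$. Then there exist constants $C$ and $C'$ such that (in the limit $\Lambda_{\min}\to\infty$, i.e. once $\Lambda_{\min}$ is large enough) $$P(\text{Type I error})+P(\text{Type II error})\ \le\ C\exp\Big(-I_{kr}-\frac12\log\Lambda_{\min}\Big)$$ and $$P(\text{Type I error})+P(\text{Type II error})\ \ge\ \exp\Big(-I_{kr}-\frac L2\big(\log\Lambda_{\min}+C'\big)\Big).$$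
   Context: $\Lambda_{\min}$ and $\|\Lambda\|_\infty$ denote the minimum and maximum entries of $\Lambda$. $I_{kr}=\sup_{s\in(0,1)}\sum_{\ell=1}^L\big[(1-s)\lambda_{k\ell}+s\lambda_{r\ell}-\lambda_{k\ell}^{1-s}\lambda_{r\ell}^s\big]$ and $\varepsilon_{kr}=\max_{\ell\in[L]}\max\big(\frac{\lambda_{k\ell}}{\lambda_{r\ell}},\frac{\lambda_{r\ell}}{\lambda_{k\ell}}\big)-1$. The likelihood ratio test decides for the hypothesis with the larger likelihood (threshold $1$ on the ratio), so the sum of its two error probabilities is $\sum_{x\in\mathbb Z_+^L}\min(\mathbb Q_k(x),\mathbb Q_r(x))$. The statement concerns a family (sequence) of pairs $(\lambda_{k*},\lambda_{r*})$ along which $\Lambda_{\min}\to\infty$. *)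

theory Defs
  imports "HOL-Probability.Probability"
begin

text \<open>
  A vector indexed by [L] is a function on the index set {1..L}; only its values there matter.
\<close>

definition poisson_vec :: "nat \<Rightarrow> (nat \<Rightarrow> real) \<Rightarrow> (nat \<Rightarrow> nat) pmf" where
  "poisson_vec L a = Pi_pmf {1..L} 0 (\<lambda>l. poisson_pmf (a l))"

definition intensities :: "nat \<Rightarrow> (nat \<Rightarrow> real) \<Rightarrow> (nat \<Rightarrow> real) \<Rightarrow> real set" where
  "intensities L a b = a ` {1..L} \<union> b ` {1..L}"

definition Lambda_min :: "nat \<Rightarrow> (nat \<Rightarrow> real) \<Rightarrow> (nat \<Rightarrow> real) \<Rightarrow> real" where
  "Lambda_min L a b = Min (intensities L a b)"

definition Lambda_max :: "nat \<Rightarrow> (nat \<Rightarrow> real) \<Rightarrow> (nat \<Rightarrow> real) \<Rightarrow> real" where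
  "Lambda_max L a b = Max (intensities L a b)"

definition chernoff_info :: "nat \<Rightarrow> (nat \<Rightarrow> real) \<Rightarrow> (nat \<Rightarrow> real) \<Rightarrow> real" where
  "chernoff_info L a b =
     (SUP s\<in>{0<..<1}. \<Sum>l\<in>{1..L}. (1 - s) * a l + s * b l - a l powr (1 - s) * b l powr s)"

definition max_rel_dev :: "nat \<Rightarrow> (nat \<Rightarrow> real) \<Rightarrow> (nat \<Rightarrow> real) \<Rightarrow> real" where
  "max_rel_dev L a b = Max ((\<lambda>l. max (a l / b l) (b l / a l)) ` {1..L}) - 1"

text \<open>
  Rejection region of the likelihood ratio test of the null hypothesis P against Q with
  threshold 1, for a sample of size 1. Ties are resolved in favour of the null hypothesis;
  the sum of the two error probabilities does not depend on that choice.
\<close>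

definition lrt_reject :: "'a pmf \<Rightarrow> 'a pmf \<Rightarrow> 'a set" where
  "lrt_reject P Q = {x. pmf P x < pmf Q x}"

definition lrt_type1 :: "'a pmf \<Rightarrow> 'a pmf \<Rightarrow> real" where
  "lrt_type1 P Q = measure_pmf.prob P (lrt_reject P Q)"

definition lrt_type2 :: "'a pmf \<Rightarrow> 'a pmf \<Rightarrow> real" where
  "lrt_type2 P Q = measure_pmf.prob Q (- lrt_reject P Q)"

lemma lrt_error_sum:
  "lrt_type1 P Q + lrt_type2 P Q = (\<Sum>\<^sub>ax. min (pmf P x) (pmf Q x))"
proof -
  let ?R = "lrt_reject P Q" and ?m = "\<lambda>x. min (pmf P x) (pmf Q x)"
  have abs: "Infinite_Set_Sum.abs_summable_on ?m A" for A
    by (rule abs_summable_on_comparison_test'[of "pmf P"]) auto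
  have "lrt_type1 P Q = infsetsum ?m ?R"
    unfolding lrt_type1_def measure_pmf_conv_infsetsum
    by (rule infsetsum_cong) (auto simp: lrt_reject_def)
  moreover have "lrt_type2 P Q = infsetsum ?m (- ?R)"
    unfolding lrt_type2_def measure_pmf_conv_infsetsum
    by (rule infsetsum_cong) (auto simp: lrt_reject_def)
  moreover have "infsetsum ?m (?R \<union> - ?R) = infsetsum ?m ?R + infsetsum ?m (- ?R)"
    by (rule infsetsum_Un_disjoint) (auto intro: abs)
  ultimately show ?thesis by (simp add: Un_commute)
qed

text \<open>
  The supremum over the reals is only meaningful for a set that is bounded above.
\<close>

lemma chernoff_info_bdd_above:
  fixes a b :: "nat \<Rightarrow> real"
  assumes "\<And>l. l \<in> {1..L} \<Longrightarrow> 0 < a l" "\<And>l. l \<in> {1..L} \<Longrightarrow> 0 < b l"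
  shows "bdd_above ((\<lambda>s. \<Sum>l\<in>{1..L}. (1 - s) * a l + s * b l - a l powr (1 - s) * b l powr s)
           ` {0<..<1})"
proof (rule bdd_aboveI2)
  fix s :: real assume s: "s \<in> {0<..<1}"
  show "(\<Sum>l\<in>{1..L}. (1 - s) * a l + s * b l - a l powr (1 - s) * b l powr s)
          \<le> (\<Sum>l\<in>{1..L}. a l + b l)"
  proof (rule sum_mono)
    fix l assume l: "l \<in> {1..L}"
    have "(1 - s) * a l \<le> a l" "s * b l \<le> b l" "0 \<le> a l powr (1 - s) * b l powr s"
      using assms(1)[OF l] assms(2)[OF l] s by (auto simp: mult_le_cancel_right1 mult_le_cancel_right2 less_imp_le)
    then show "(1 - s) * a l + s * b l - a l powr (1 - s) * b l powr s \<le> a l + b l"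
      by linarith
  qed
qed

end

theory Submission
  imports Defs
begin

text \<open>
  Let $P$ and $Q$ be the two product Poisson laws with rates $a$ and $b$. For $0 < s < 1$ the
  normalised geometric mean of $P$ and $Q$ with weights $1 - s$ and $s$ is the product Poisson law
  $R$ with rates $c_l = a_l^{1-s} b_l^s$, and with the log-likelihood ratio
  $T = \ln (Q/P)$ one has $P = e^{-f(s)} R e^{-sT}$ and $Q = e^{-f(s)} R e^{(1-s)T}$, where $f$ is the
  function whose supremum is the Chernoff information $I$. Hence the error sum is exactly
  \[ e^{-f(s)} \, E_R \min (e^{-sT}, e^{(1-s)T}) \]
  (\<open>lrt_error_eq_expectation\<close>). Since $f$ vanishes at $0$ and $1$ and is positive at $1/2$, its maximum
  is attained at an interior point, where $f' = 0$ means $E_R T = 0$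
  (\<open>chernoff_exponent_maximiser\<close>). This $s$ is used from now on, so that $f(s) = I$.

  Upper bound. The minimum is at most $e^{-\eta |T|}$ with $\eta = \min (s, 1 - s)$. In a coordinate
  $l$ whose rates have a ratio bounded away from $1$, the values of $T$, given the other coordinates,
  form a lattice whose spacing is bounded below, and each value has probability at most
  $2/\sqrt{c_l}$. Summing a geometric series bounds the expectation by a constant times
  $\Lambda_{\min}^{-1/2}$ (\<open>lrt_error_le\<close>). The constant is uniform because $\eta$ is bounded
  away from $0$: $f(1/2)$ is at least a multiple of $\Lambda_{\min}$, while $f(s)$ is at most a multiple
  of $\Lambda_{\min} \min (s, 1 - s)$, as all rates are comparable to $\Lambda_{\min}$
  (\<open>chernoff_exponent_half_ge\<close>, \<open>chernoff_exponent_le\<close>).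

  Lower bound. The single point $x_l = \lfloor c_l \rfloor$ suffices. There $|T|$ is bounded since
  $E_R T = 0$ and rounding changes each coordinate by at most $1$, and $R(x)$ is a product of $L$ Poisson
  probabilities at the mode, each of order $\Lambda_{\min}^{-1/2}$ (\<open>lrt_error_ge\<close>).

  Both estimates on Poisson probabilities come from Stirling bounds for the factorial.
\<close>

section \<open>Stirling bounds and Poisson probabilities\<close>

text \<open>
  Stirling's formula up to a constant factor. With $D(n) = \ln n! - (n + 1/2) \ln n + n$ the
  increment $D(n+1) - D(n) = 1 - (n + 1/2) \ln (1 + 1/n)$ lies between
  $1/(4(n+1)) - 1/(4n)$ and $0$, by comparing the integral of $1/x$ over $[n, n+1]$ with the
  trapezoidal and the midpoint rule. As the lower bounds telescope, $D$ stays between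
  $3/4$ and $D(1) = 1$.
\<close>

lemma ln_fact_bounds:
  fixes n :: nat
  assumes "n \<ge> 1"
  shows "(real n + 1/2) * ln n - n \<le> ln (fact n)" "ln (fact n) \<le> (real n + 1/2) * ln n - n + 1"
proof -
  define D :: "nat \<Rightarrow> real" where "D n = ln (fact n) - (real n + 1/2) * ln n + n" for n
  have step: "D (Suc n) - D n = 1 - (real n + 1/2) * (ln (real n + 1) - ln n)" if "n \<ge> 1" for n
  proof -
    have "ln (fact (Suc n) :: real) = ln (real n + 1) + ln (fact n)"
      unfolding fact_Suc of_nat_mult of_nat_fact by (subst ln_mult) (auto simp: add.commute)
    then show ?thesis unfolding D_def by (simp add: algebra_simps)
  qed
  have dec: "D (Suc n) \<le> D n" if n: "n \<ge> 1" for n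
  proof -
    have "1 = (real n + 1/2) * (2 * ((real n + 1) - n) / (n + (real n + 1)))"
      by (simp add: field_simps)
    also have "\<dots> \<le> (real n + 1/2) * (ln (real n + 1) - ln n)"
      by (rule mult_left_mono[OF ln_inverse_approx_ge]) (use n in auto)
    finally show ?thesis using step[OF n] by simp
  qed
  have inc: "D n - 1 / (4 * n) \<le> D (Suc n) - 1 / (4 * Suc n)" if n: "n \<ge> 1" for n
  proof -
    have "(real n + 1/2) * (ln (real n + 1) - ln n)
        \<le> (real n + 1/2) * (1 * (inverse (real n) + inverse (real n + 1)) / 2)"
      by (rule mult_left_mono[OF ln_inverse_approx_le]) (use n in auto)
    also have "\<dots> = 1 + 1 / (4 * n) - 1 / (4 * (real n + 1))"
      using n by (simp add: divide_simps) (simp add: algebra_simps)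
    finally show ?thesis using step[OF n] by (simp add: algebra_simps)
  qed
  have "D n \<le> 1" using assms
  proof (induction n rule: nat_induct_at_least)
    case base show ?case by (simp add: D_def)
  next
    case (Suc n) then show ?case using dec[of n] by linarith
  qed
  moreover have "3 / 4 \<le> D n - 1 / (4 * n)" using assms
  proof (induction n rule: nat_induct_at_least)
    case base show ?case by (simp add: D_def)
  next
    case (Suc n) then show ?case using inc[of n] by linarith
  qed
  moreover have "0 \<le> 1 / (4 * real n)" by simp
  ultimately show "(real n + 1/2) * ln n - n \<le> ln (fact n)" "ln (fact n) \<le> (real n + 1/2) * ln n - n + 1"
    unfolding D_def by linarith+
qed

lemma pmf_poisson_exp:
  fixes c :: real
  assumes "c > 0"
  shows "pmf (poisson_pmf c) k = exp (real k * ln c - c - ln (fact k))"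
  using assms by (simp add: exp_diff exp_of_nat_mult exp_minus inverse_eq_divide)

text \<open>
  At $k \ge c/2$ Stirling's formula gives $1/\sqrt k$ times a factor that is largest for $k = c$.
  Below $c/2$ this estimate degenerates, but there the mass function is increasing
  up to $\lfloor c \rfloor$, where the first case applies.
\<close>

lemma pmf_poisson_le:
  fixes c :: real
  assumes c: "c \<ge> 1"
  shows "pmf (poisson_pmf c) k \<le> 2 / sqrt c"
proof -
  have large: "pmf (poisson_pmf c) j \<le> 2 / sqrt c" if j: "c / 2 \<le> real j" for j
  proof -
    have j0: "j \<ge> 1" using j c by (cases j) auto
    have "real j * (ln c - ln j) \<le> c - j"
      using ln_le_minus_one[of "c / j"] j0 c by (simp add: ln_div field_simps)
    moreover have "(real j + 1/2) * ln j - j \<le> ln (fact j)"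
      by (rule ln_fact_bounds(1)[OF j0])
    ultimately have "real j * ln c - c - ln (fact j) \<le> - (1/2 * ln j)"
      by (simp add: algebra_simps)
    then have "pmf (poisson_pmf c) j \<le> exp (- (1/2 * ln j))"
      using c by (simp add: pmf_poisson_exp del: pmf_poisson)
    also have "\<dots> = 1 / sqrt j"
      using j0 by (simp add: exp_minus ln_sqrt[symmetric] inverse_eq_divide)
    also have "\<dots> \<le> 1 / sqrt (c / 4)"
      using j c by (intro divide_left_mono) auto
    also have "\<dots> = 2 / sqrt c"
      by (simp add: real_sqrt_divide)
    finally show ?thesis .
  qed
  show ?thesis
  proof (cases "c / 2 \<le> real k")
    case True then show ?thesis by (rule large)
  next
    case False
    define n where "n = nat \<lfloor>c\<rfloor>"
    have n: "real n \<le> c" "c - 1 < real n" "n \<ge> 1" using c unfolding n_def by linarith+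
    have "k \<le> n" using False n c by linarith
    have up: "pmf (poisson_pmf c) i \<le> pmf (poisson_pmf c) (Suc i)" if i: "i < n" for i
    proof -
      have i': "real (Suc i) \<le> c" using i n by linarith
      have "pmf (poisson_pmf c) i * 1 \<le> pmf (poisson_pmf c) i * (c / Suc i)"
        using i' by (intro mult_left_mono pmf_nonneg) simp
      also have "\<dots> = pmf (poisson_pmf c) (Suc i)"
        using c by (simp add: field_simps)
      finally show ?thesis by simp
    qed
    have "pmf (poisson_pmf c) k \<le> pmf (poisson_pmf c) n"
      using \<open>k \<le> n\<close>
    proof (induction k rule: inc_induct)
      case (step i) then show ?case using up[of i] by (auto intro: order_trans)
    qed simp
    also have "\<dots> \<le> 2 / sqrt c" using n by (intro large) linarith
    finally show ?thesis .
  qed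
qed

text \<open>
  The value at the mode shows that the order $1/\sqrt c$ of the uniform bound is attained.
\<close>

lemma pmf_poisson_floor_ge:
  fixes c :: real
  assumes c: "c \<ge> 1"
  shows "exp (- 2 - ln c / 2) \<le> pmf (poisson_pmf c) (nat \<lfloor>c\<rfloor>)"
proof -
  define n where "n = nat \<lfloor>c\<rfloor>"
  have n: "real n \<le> c" "c - 1 < real n" "n \<ge> 1" using c unfolding n_def by linarith+
  have ln: "ln (real n) \<le> ln c" using n by simp
  have "real n * ln n \<le> real n * ln c" using ln by (intro mult_left_mono) auto
  moreover have "ln (fact n) \<le> (real n + 1/2) * ln n - n + 1" by (rule ln_fact_bounds(2)[OF n(3)])
  ultimately have "- 2 - ln c / 2 \<le> real n * ln c - c - ln (fact n)"
    using n ln unfolding distrib_right by linarith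
  then show ?thesis
    using c unfolding n_def[symmetric] by (simp add: pmf_poisson_exp del: pmf_poisson)
qed

text \<open>
  Integers keep a distance of at least $0, 1, 2, \dots$ from $z$ on either side, so that the integrand
  is dominated by two geometric sequences. This is where a bound on the single atoms of a
  distribution turns into a bound on the mass near a point.
\<close>

lemma nn_integral_exp_abs_le:
  fixes p :: "nat pmf" and r M z :: real
  assumes r: "r > 0" and M: "\<And>k. pmf p k \<le> M"
  shows "(\<integral>\<^sup>+k. ennreal (exp (- r * \<bar>real k - z\<bar>)) \<partial>measure_pmf p) \<le> ennreal (M * (2 / (1 - exp (- r))))"
proof -
  define q where "q = exp (- r)"
  have q: "0 < q" "q < 1" using r by (auto simp: q_def)
  define n where "n = nat \<lfloor>z\<rfloor>"
  (* If z < 0, then n = 0, and the two majorants are still valid, though not sharp. *)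
  define g where "g k = (if k \<le> n then q ^ (n - k) else q ^ (k - Suc n))" for k
  have M0: "0 \<le> M" using M[of 0] pmf_nonneg[of p 0] by linarith
  have qpow: "q ^ j = exp (- r * real j)" for j
    unfolding q_def by (simp add: exp_of_nat_mult[symmetric] mult.commute)
  have g: "exp (- r * \<bar>real k - z\<bar>) \<le> g k" for k
  proof (cases "k \<le> n")
    case True
    have "real (n - k) \<le> \<bar>real k - z\<bar>"
      using True unfolding n_def by (simp add: of_nat_diff) linarith
    then show ?thesis using True r by (simp add: g_def qpow mult_left_mono)
  next
    case False
    have "real (k - Suc n) \<le> \<bar>real k - z\<bar>"
      using False unfolding n_def by (simp add: of_nat_diff) linarith
    then show ?thesis using False r by (simp add: g_def qpow mult_left_mono)
  qed
  have g0: "0 \<le> g k" for k using q by (auto simp: g_def)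
  have tail: "(\<lambda>k. g (k + Suc n)) = (\<lambda>k. q ^ k)" by (auto simp: g_def)
  have geo: "(\<lambda>k. q ^ k) sums (1 / (1 - q))" using q by (intro geometric_sums) auto
  have sg: "summable g"
    using geo unfolding tail[symmetric] by (metis sums_summable summable_iff_shift)
  have "(\<Sum>k<Suc n. g k) = (\<Sum>k<Suc n. q ^ (n - k))" by (intro sum.cong) (auto simp: g_def)
  also have "\<dots> = (\<Sum>k<Suc n. q ^ k)"
    by (rule sum.reindex_bij_witness[of _ "\<lambda>k. n - k" "\<lambda>k. n - k"]) auto
  also have "\<dots> \<le> 1 / (1 - q)"
    using sum_le_suminf[OF sums_summable[OF geo], of "{..<Suc n}"] sums_unique[OF geo] q by auto
  finally have "suminf g \<le> 2 / (1 - q)"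
    using suminf_split_initial_segment[OF sg, of "Suc n"] sums_unique[OF geo] unfolding tail by simp
  moreover have "(\<integral>\<^sup>+k. ennreal (exp (- r * \<bar>real k - z\<bar>)) \<partial>measure_pmf p)
      \<le> (\<integral>\<^sup>+k. ennreal (M * g k) \<partial>count_space UNIV)"
    unfolding nn_integral_measure_pmf
        using mult_mono[OF M g M0 exp_ge_zero]
    by (intro nn_integral_mono) (simp add: ennreal_mult'[symmetric] ennreal_leI)
  moreover have "(\<integral>\<^sup>+k. ennreal (M * g k) \<partial>count_space UNIV) = ennreal (M * suminf g)"
    using M0 g0 sg by (simp add: nn_integral_count_space_nat suminf_ennreal2 suminf_mult summable_mult)
  ultimately show ?thesis
    unfolding q_def[symmetric] by (smt (verit) M0 ennreal_leI mult_left_mono order_trans)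
qed

section \<open>The tilted Poisson law and the error of the likelihood ratio test\<close>

definition tilted_rate :: "real \<Rightarrow> real \<Rightarrow> real \<Rightarrow> real" where
  "tilted_rate a b s = a powr (1 - s) * b powr s"

definition chernoff_exponent :: "nat \<Rightarrow> (nat \<Rightarrow> real) \<Rightarrow> (nat \<Rightarrow> real) \<Rightarrow> real \<Rightarrow> real" where
  "chernoff_exponent L a b s = (\<Sum>l\<in>{1..L}. (1 - s) * a l + s * b l - tilted_rate (a l) (b l) s)"

text \<open>
  The logarithm of the likelihood ratio of \<open>b\<close> against \<open>a\<close> at the observation \<open>x\<close>.
\<close>

definition poisson_llr :: "nat \<Rightarrow> (nat \<Rightarrow> real) \<Rightarrow> (nat \<Rightarrow> real) \<Rightarrow> (nat \<Rightarrow> nat) \<Rightarrow> real" where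
  "poisson_llr L a b x = (\<Sum>l\<in>{1..L}. a l - b l + real (x l) * ln (b l / a l))"

lemma tilted_rate_pos: "a > 0 \<Longrightarrow> b > 0 \<Longrightarrow> tilted_rate a b s > 0"
  by (simp add: tilted_rate_def)

lemma tilted_rate_swap: "tilted_rate b a (1 - s) = tilted_rate a b s"
  by (simp add: tilted_rate_def mult.commute)

lemma tilted_rate_eq_exp:
  assumes "a > 0" "b > 0"
  shows "tilted_rate a b s = a * exp (s * ln (b / a))"
  using assms by (simp add: tilted_rate_def powr_def ln_div algebra_simps exp_diff exp_add)

lemma ln_tilted_rate:
  assumes "a > 0" "b > 0"
  shows "ln (tilted_rate a b s) = (1 - s) * ln a + s * ln b"
  using assms by (simp add: tilted_rate_def ln_mult ln_powr)

lemma tilted_rate_bounds: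
  assumes s: "0 \<le> s" "s \<le> 1" and m: "0 < m" and "a \<in> {m..M}" "b \<in> {m..M}"
  shows "tilted_rate a b s \<in> {m..M}"
proof -
  have ab: "a > 0" "b > 0" "M > 0" using assms by auto
  have "(1 - s) * ln m + s * ln m \<le> (1 - s) * ln a + s * ln b"
    using assms ab by (intro add_mono mult_left_mono) auto
  moreover have "(1 - s) * ln a + s * ln b \<le> (1 - s) * ln M + s * ln M"
    using assms ab by (intro add_mono mult_left_mono) auto
  ultimately have "ln m \<le> ln (tilted_rate a b s)" "ln (tilted_rate a b s) \<le> ln M"
    using ab by (simp_all add: ln_tilted_rate algebra_simps)
  then show ?thesis using ab m tilted_rate_pos[of a b s] by simp
qed

lemma chernoff_exponent_swap: "chernoff_exponent L b a (1 - s) = chernoff_exponent L a b s"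
  unfolding chernoff_exponent_def by (intro sum.cong) (auto simp: tilted_rate_swap)

lemma poisson_llr_swap:
  assumes "\<And>l. l \<in> {1..L} \<Longrightarrow> 0 < a l" "\<And>l. l \<in> {1..L} \<Longrightarrow> 0 < b l"
  shows "poisson_llr L b a x = - poisson_llr L a b x"
proof -
  have "b l - a l + real (x l) * ln (a l / b l) = - (a l - b l + real (x l) * ln (b l / a l))"
    if "l \<in> {1..L}" for l
    using assms[OF that] by (simp add: ln_div algebra_simps)
  then show ?thesis unfolding poisson_llr_def sum_negf[symmetric] by (intro sum.cong) auto
qed

text \<open>
  The normalised weighted geometric mean of two Poisson laws is again a Poisson law, with the
  weighted geometric mean of the rates as its rate. Each of the two laws is hence an exponential
  tilt of this intermediate law by a multiple of the log-likelihood ratio.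
\<close>

lemma pmf_poisson_tilt:
  assumes "a > 0" "b > 0"
  shows "pmf (poisson_pmf a) k =
    exp (- ((1 - s) * a + s * b - tilted_rate a b s)) * pmf (poisson_pmf (tilted_rate a b s)) k *
    exp (- s * (a - b + real k * ln (b / a)))"
proof -
  note e = pmf_poisson_exp[OF assms(1)] pmf_poisson_exp[OF tilted_rate_pos[OF assms]]
  show ?thesis
    using assms unfolding e exp_add[symmetric] ln_tilted_rate[OF assms]
    by (simp add: ln_div algebra_simps)
qed

lemma pmf_poisson_vec_tilt:
  assumes "\<And>l. l \<in> {1..L} \<Longrightarrow> 0 < a l" "\<And>l. l \<in> {1..L} \<Longrightarrow> 0 < b l"
  shows "pmf (poisson_vec L a) x =
    exp (- chernoff_exponent L a b s) * pmf (poisson_vec L (\<lambda>l. tilted_rate (a l) (b l) s)) x *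
    exp (- s * poisson_llr L a b x)"
proof (cases "\<forall>l. l \<notin> {1..L} \<longrightarrow> x l = 0")
  case False
  then show ?thesis unfolding poisson_vec_def by (subst (1 2) pmf_Pi) auto
next
  case True
  have "pmf (poisson_vec L a) x = (\<Prod>l\<in>{1..L}. pmf (poisson_pmf (a l)) (x l))"
    unfolding poisson_vec_def using True by (intro pmf_Pi') auto
  also have "\<dots> = (\<Prod>l\<in>{1..L}.
      exp (- ((1 - s) * a l + s * b l - tilted_rate (a l) (b l) s)) *
      pmf (poisson_pmf (tilted_rate (a l) (b l) s)) (x l) *
      exp (- s * (a l - b l + real (x l) * ln (b l / a l))))"
    by (intro prod.cong refl pmf_poisson_tilt assms) 
  also have "\<dots> = exp (- chernoff_exponent L a b s) *
      (\<Prod>l\<in>{1..L}. pmf (poisson_pmf (tilted_rate (a l) (b l) s)) (x l)) *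
      exp (- s * poisson_llr L a b x)"
    unfolding prod.distrib chernoff_exponent_def poisson_llr_def sum_distrib_left sum_negf[symmetric]
    by (simp only: exp_sum finite_atLeastAtMost)
  also have "(\<Prod>l\<in>{1..L}. pmf (poisson_pmf (tilted_rate (a l) (b l) s)) (x l)) =
      pmf (poisson_vec L (\<lambda>l. tilted_rate (a l) (b l) s)) x"
    unfolding poisson_vec_def using True by (intro pmf_Pi'[symmetric]) auto
  finally show ?thesis .
qed

text \<open>
  Under the intermediate law the minimum of the two likelihoods becomes the minimum of two
  exponentials of the log-likelihood ratio $t$, one decaying to the right at rate $s$ and the other
  to the left at rate $1 - s$. A two-sided decay therefore needs $s$ away from both $0$ and $1$.
\<close>

lemma min_exp_le_exp_abs:
  fixes \<eta> s t :: real
  assumes "\<eta> \<le> s" "\<eta> \<le> 1 - s"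
  shows "min (exp (- s * t)) (exp ((1 - s) * t)) \<le> exp (- \<eta> * \<bar>t\<bar>)"
proof (cases "0 \<le> t")
  case True
  then have "\<eta> * t \<le> s * t" using assms by (intro mult_right_mono)
  then show ?thesis using True by (intro min.coboundedI1) simp
next
  case False
  then have "\<eta> * (- t) \<le> (1 - s) * (- t)" using assms by (intro mult_right_mono) auto
  then show ?thesis using False by (intro min.coboundedI2) simp
qed

lemma exp_abs_le_min_exp:
  fixes s t :: real
  assumes "0 \<le> s" "s \<le> 1"
  shows "exp (- \<bar>t\<bar>) \<le> min (exp (- s * t)) (exp ((1 - s) * t))"
proof -
  have "\<bar>s * t\<bar> \<le> 1 * \<bar>t\<bar>" "\<bar>(1 - s) * t\<bar> \<le> 1 * \<bar>t\<bar>"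
    using assms unfolding abs_mult by (intro mult_right_mono; simp)+
  then show ?thesis unfolding min.bounded_iff exp_le_cancel_iff mult_minus_left by linarith
qed

text \<open>
  The exponential factor of the error is explicit here for every \<open>s\<close>; all that remains is
  the expectation under the intermediate law, which governs the polynomial factor.
\<close>

lemma lrt_error_eq_expectation:
  fixes L :: nat and a b :: "nat \<Rightarrow> real" and s :: real
  assumes pos: "\<And>l. l \<in> {1..L} \<Longrightarrow> 0 < a l" "\<And>l. l \<in> {1..L} \<Longrightarrow> 0 < b l"
    and s: "0 \<le> s" "s \<le> 1"
  defines "R \<equiv> poisson_vec L (\<lambda>l. tilted_rate (a l) (b l) s)"
  shows "lrt_type1 (poisson_vec L a) (poisson_vec L b) + lrt_type2 (poisson_vec L a) (poisson_vec L b) =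
    exp (- chernoff_exponent L a b s) *
    measure_pmf.expectation R
      (\<lambda>x. min (exp (- s * poisson_llr L a b x)) (exp ((1 - s) * poisson_llr L a b x)))"
    (is "_ = _ * measure_pmf.expectation R ?w")
proof -
  have P: "pmf (poisson_vec L a) x =
      exp (- chernoff_exponent L a b s) * pmf R x * exp (- s * poisson_llr L a b x)" for x
    unfolding R_def by (rule pmf_poisson_vec_tilt[OF pos])
  have swap: "poisson_llr L b a x = - poisson_llr L a b x" for x
    by (rule poisson_llr_swap) (fact pos)+
  have "pmf (poisson_vec L b) x =
      exp (- chernoff_exponent L a b s) * pmf R x * exp ((1 - s) * poisson_llr L a b x)" for x
    using pmf_poisson_vec_tilt[of L b a x "1 - s", OF pos(2,1)]
    by (simp add: R_def tilted_rate_swap chernoff_exponent_swap swap algebra_simps)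
  then have "min (pmf (poisson_vec L a) x) (pmf (poisson_vec L b) x) =
      exp (- chernoff_exponent L a b s) * (pmf R x * ?w x)" for x
    unfolding P by (simp only: mult.assoc min_mult_distrib_left exp_ge_zero pmf_nonneg if_True)
  moreover have "Infinite_Set_Sum.abs_summable_on (\<lambda>x. pmf R x * ?w x) UNIV"
  proof (rule abs_summable_on_comparison_test'[of "\<lambda>x. pmf R x"])
    have w1: "?w x \<le> 1" for x
      using min_exp_le_exp_abs[of 0 s "poisson_llr L a b x"] s by simp
    show "norm (pmf R x * ?w x) \<le> pmf R x" for x
      using w1[of x] by (simp add: abs_mult mult_left_le)
  qed (rule pmf_abs_summable)
  ultimately show ?thesis
    unfolding lrt_error_sum pmf_expectation_eq_infsetsum by (simp add: infsetsum_cmult_right)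
qed

text \<open>
  One coordinate \<open>l\<close> suffices: given all the others, the affine form is a point of a lattice
  of spacing $|d_l|$, shifted by an unknown offset, and the one-dimensional bound is uniform in
  that offset.
\<close>

section \<open>Bounds for a given tilt\<close>

lemma nn_integral_poisson_vec_exp_abs_le:
  fixes c d t :: "nat \<Rightarrow> real" and \<eta> :: real
  assumes l: "l \<in> {1..L}" and c: "c l \<ge> 1" and d: "d l \<noteq> 0" and \<eta>: "\<eta> > 0"
  shows "(\<integral>\<^sup>+x. ennreal (exp (- \<eta> * \<bar>\<Sum>j\<in>{1..L}. t j + real (x j) * d j\<bar>)) \<partial>measure_pmf (poisson_vec L c))
    \<le> ennreal (2 / sqrt (c l) * (2 / (1 - exp (- (\<eta> * \<bar>d l\<bar>)))))"
proof -
  define A where "A = {1..L} - {l}"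
  have A: "{1..L} = insert l A" "finite A" "l \<notin> A" using l by (auto simp: A_def)
  let ?h = "\<lambda>x :: nat \<Rightarrow> nat. ennreal (exp (- \<eta> * \<bar>\<Sum>j\<in>{1..L}. t j + real (x j) * d j\<bar>))"
  let ?B = "ennreal (2 / sqrt (c l) * (2 / (1 - exp (- (\<eta> * \<bar>d l\<bar>)))))"
  have inner: "(\<integral>\<^sup>+k. ?h (f(l := k)) \<partial>measure_pmf (poisson_pmf (c l))) \<le> ?B" for f
  proof -
    define u where "u = t l + (\<Sum>j\<in>A. t j + real (f j) * d j)"
    have "(\<Sum>j\<in>A. t j + real ((f(l := k)) j) * d j) = (\<Sum>j\<in>A. t j + real (f j) * d j)" for k
      using A(3) by (intro sum.cong) auto
    then have "(\<Sum>j\<in>{1..L}. t j + real ((f(l := k)) j) * d j) = u + real k * d l" for k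
      unfolding A(1) u_def using A(2,3) by simp
    moreover have "u + real k * d l = d l * (real k - (- u / d l))" for k
      using d by (simp add: field_simps)
    ultimately have "?h (f(l := k)) = ennreal (exp (- (\<eta> * \<bar>d l\<bar>) * \<bar>real k - (- u / d l)\<bar>))" for k
      by (simp only: abs_mult mult.assoc mult_minus_left)
    then show ?thesis
      using nn_integral_exp_abs_le[of "\<eta> * \<bar>d l\<bar>" "poisson_pmf (c l)" "2 / sqrt (c l)" "- u / d l"]
        pmf_poisson_le[OF c] \<eta> d by (simp add: mult.assoc del: pmf_poisson)
  qed
  have "poisson_vec L c = map_pmf (\<lambda>(y, f). f(l := y))
      (pair_pmf (poisson_pmf (c l)) (Pi_pmf A 0 (\<lambda>j. poisson_pmf (c j))))"
    unfolding poisson_vec_def A(1) by (rule Pi_pmf_insert[OF A(2,3)])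
  also have "\<dots> = map_pmf (\<lambda>(f, y). f(l := y))
      (pair_pmf (Pi_pmf A 0 (\<lambda>j. poisson_pmf (c j))) (poisson_pmf (c l)))"
    by (subst pair_commute_pmf) (simp add: pmf.map_comp o_def case_prod_unfold)
  finally have "(\<integral>\<^sup>+x. ?h x \<partial>measure_pmf (poisson_vec L c)) =
      (\<integral>\<^sup>+f. \<integral>\<^sup>+k. ?h (f(l := k)) \<partial>measure_pmf (poisson_pmf (c l))
        \<partial>measure_pmf (Pi_pmf A 0 (\<lambda>j. poisson_pmf (c j))))"
    by (simp only: nn_integral_map_pmf nn_integral_pair_pmf' prod.case)
  also have "\<dots> \<le> (\<integral>\<^sup>+f. ?B \<partial>measure_pmf (Pi_pmf A 0 (\<lambda>j. poisson_pmf (c j))))"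
    by (intro nn_integral_mono inner)
  also have "\<dots> = ?B" by simp
  finally show ?thesis .
qed

text \<open>
  The hypothesis on \<open>\<delta>\<close> makes the lattice of values of the log-likelihood ratio in coordinate
  \<open>l\<close> coarse, which costs only a constant, and the atoms in that coordinate are of order
  $1/\sqrt m$.
\<close>

lemma lrt_error_le:
  fixes L :: nat and a b :: "nat \<Rightarrow> real" and s m M \<eta> \<delta> :: real
  assumes a: "\<And>l. l \<in> {1..L} \<Longrightarrow> a l \<in> {m..M}" and b: "\<And>l. l \<in> {1..L} \<Longrightarrow> b l \<in> {m..M}"
    and m: "1 \<le> m" and s: "\<eta> \<le> s" "\<eta> \<le> 1 - s" and \<eta>: "0 < \<eta>" and \<delta>: "0 < \<delta>"
    and l: "l \<in> {1..L}" "\<delta> \<le> \<bar>ln (b l / a l)\<bar>"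
  shows "lrt_type1 (poisson_vec L a) (poisson_vec L b) + lrt_type2 (poisson_vec L a) (poisson_vec L b)
    \<le> exp (- chernoff_exponent L a b s) * (4 / (1 - exp (- (\<eta> * \<delta>))) / sqrt m)"
proof -
  have pos: "\<And>l. l \<in> {1..L} \<Longrightarrow> 0 < a l" "\<And>l. l \<in> {1..L} \<Longrightarrow> 0 < b l"
    using a b m by force+
  have s01: "0 \<le> s" "s \<le> 1" using s \<eta> by auto
  define c where "c j = tilted_rate (a j) (b j) s" for j
  let ?w = "\<lambda>x. min (exp (- s * poisson_llr L a b x)) (exp ((1 - s) * poisson_llr L a b x))"
  have cl: "m \<le> c l" unfolding c_def
    using tilted_rate_bounds[OF s01, of m "a l" M "b l"] a b l m by auto
  have "(\<integral>\<^sup>+x. ennreal (?w x) \<partial>measure_pmf (poisson_vec L c))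
      \<le> (\<integral>\<^sup>+x. ennreal (exp (- \<eta> * \<bar>poisson_llr L a b x\<bar>)) \<partial>measure_pmf (poisson_vec L c))"
    by (intro nn_integral_mono ennreal_leI min_exp_le_exp_abs s)
  also have "\<dots> \<le> ennreal (2 / sqrt (c l) * (2 / (1 - exp (- (\<eta> * \<bar>ln (b l / a l)\<bar>)))))"
    unfolding poisson_llr_def
    by (rule nn_integral_poisson_vec_exp_abs_le) (use cl m l \<eta> \<delta> in auto)
  also have "\<dots> \<le> ennreal (4 / (1 - exp (- (\<eta> * \<delta>))) / sqrt m)"
  proof (rule ennreal_leI)
    have A: "2 / sqrt (c l) \<le> 2 / sqrt m"
      using cl m by (intro divide_left_mono) auto
    have "\<eta> * \<delta> \<le> \<eta> * \<bar>ln (b l / a l)\<bar>" using l \<eta> by (intro mult_left_mono) auto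
    moreover have "0 < \<eta> * \<delta>" using \<eta> \<delta> by simp
    ultimately have "2 / (1 - exp (- (\<eta> * \<bar>ln (b l / a l)\<bar>))) \<le> 2 / (1 - exp (- (\<eta> * \<delta>)))"
      by (intro divide_left_mono mult_pos_pos) auto
    with A have "2 / sqrt (c l) * (2 / (1 - exp (- (\<eta> * \<bar>ln (b l / a l)\<bar>))))
        \<le> 2 / sqrt m * (2 / (1 - exp (- (\<eta> * \<delta>))))"
      using m \<eta> by (intro mult_mono) auto
    then show "2 / sqrt (c l) * (2 / (1 - exp (- (\<eta> * \<bar>ln (b l / a l)\<bar>))))
        \<le> 4 / (1 - exp (- (\<eta> * \<delta>))) / sqrt m" by (simp add: mult.commute)
  qed
  finally have bound: "measure_pmf.expectation (poisson_vec L c) ?w \<le> 4 / (1 - exp (- (\<eta> * \<delta>))) / sqrt m"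
    using \<eta> \<delta> m by (intro integral_real_bounded) auto
  have err: "lrt_type1 (poisson_vec L a) (poisson_vec L b) + lrt_type2 (poisson_vec L a) (poisson_vec L b) =
      exp (- chernoff_exponent L a b s) * measure_pmf.expectation (poisson_vec L c) ?w"
    unfolding c_def by (rule lrt_error_eq_expectation) (use pos s01 in auto)
  show ?thesis
    unfolding err by (intro mult_left_mono bound) auto
qed

text \<open>
  A single observation \<open>x\<close> is enough: the mean of the intermediate law, rounded down.
  Stationarity says that the log-likelihood ratio has mean zero under that law, so it
  is bounded at \<open>x\<close> by the rounding error, and each of the \<open>L\<close> coordinates contributes the
  factor $1/\sqrt{W m}$ of a mode.
\<close>

lemma lrt_error_ge:
  fixes L :: nat and a b :: "nat \<Rightarrow> real" and s m W :: real
  assumes a: "\<And>l. l \<in> {1..L} \<Longrightarrow> a l \<in> {m..W * m}" and b: "\<And>l. l \<in> {1..L} \<Longrightarrow> b l \<in> {m..W * m}"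
    and m: "1 \<le> m" and W: "1 \<le> W" and s: "0 \<le> s" "s \<le> 1"
    and stat: "(\<Sum>l\<in>{1..L}. a l - b l + tilted_rate (a l) (b l) s * ln (b l / a l)) = 0"
  shows "exp (- chernoff_exponent L a b s - real L / 2 * (ln m + (4 + 3 * ln W)))
    \<le> lrt_type1 (poisson_vec L a) (poisson_vec L b) + lrt_type2 (poisson_vec L a) (poisson_vec L b)"
proof -
  have pos: "\<And>l. l \<in> {1..L} \<Longrightarrow> 0 < a l" "\<And>l. l \<in> {1..L} \<Longrightarrow> 0 < b l"
    using a b m by force+
  define c where "c j = tilted_rate (a j) (b j) s" for j
  have c: "c l \<in> {m..W * m}" if "l \<in> {1..L}" for l
    unfolding c_def using a b that m by (intro tilted_rate_bounds s) auto
  define x :: "nat \<Rightarrow> nat" where "x l = (if l \<in> {1..L} then nat \<lfloor>c l\<rfloor> else 0)" for l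
  let ?w = "\<lambda>x. min (exp (- s * poisson_llr L a b x)) (exp ((1 - s) * poisson_llr L a b x))"
  have x: "\<bar>real (x l) - c l\<bar> \<le> 1" if "l \<in> {1..L}" for l
    using that c[OF that] m unfolding x_def by simp linarith
  have lnba: "\<bar>ln (b l / a l)\<bar> \<le> ln W" if l: "l \<in> {1..L}" for l
  proof -
    have le: "ln m \<le> ln (a l)" "ln (a l) \<le> ln (W * m)" "ln m \<le> ln (b l)" "ln (b l) \<le> ln (W * m)"
      using a[OF l] b[OF l] pos[OF l] m W by (subst ln_le_cancel_iff; auto)+
    have "ln (W * m) = ln W + ln m" using m W by (intro ln_mult_pos) auto
    moreover have "ln (b l / a l) = ln (b l) - ln (a l)" using pos[OF l] by (simp add: ln_div)
    ultimately show ?thesis using le by linarith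
  qed
  have "poisson_llr L a b x = (\<Sum>l\<in>{1..L}. (real (x l) - c l) * ln (b l / a l)) +
      (\<Sum>l\<in>{1..L}. a l - b l + c l * ln (b l / a l))"
    unfolding poisson_llr_def sum.distrib[symmetric] by (intro sum.cong) (auto simp: algebra_simps)
  then have "\<bar>poisson_llr L a b x\<bar> \<le> (\<Sum>l\<in>{1..L}. \<bar>(real (x l) - c l) * ln (b l / a l)\<bar>)"
    using stat by (simp add: c_def sum_abs)
  also have "\<dots> \<le> (\<Sum>l\<in>{1..L}. 1 * ln W)"
    unfolding abs_mult by (intro sum_mono mult_mono x lnba) auto
  finally have "\<bar>poisson_llr L a b x\<bar> \<le> L * ln W" by simp
  then have "exp (- (L * ln W)) \<le> exp (- \<bar>poisson_llr L a b x\<bar>)" by simp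
  also have "\<dots> \<le> ?w x" by (rule exp_abs_le_min_exp[OF s])
  finally have T: "exp (- (L * ln W)) \<le> ?w x" .
  have "exp (- L * (2 + (ln m + ln W) / 2)) = (\<Prod>l\<in>{1..L}. exp (- (2 + (ln m + ln W) / 2)))"
    by (simp add: exp_of_nat_mult[symmetric]) (simp add: field_simps)
  also have "\<dots> \<le> (\<Prod>l\<in>{1..L}. pmf (poisson_pmf (c l)) (nat \<lfloor>c l\<rfloor>))"
  proof (intro prod_mono conjI)
    fix l assume l: "l \<in> {1..L}"
    have "ln (c l) \<le> ln (W * m)" using c[OF l] m by simp
    also have "\<dots> = ln W + ln m" using m W by (intro ln_mult_pos) auto
    finally have "exp (- (2 + (ln m + ln W) / 2)) \<le> exp (- 2 - ln (c l) / 2)" by simp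
    also have "\<dots> \<le> pmf (poisson_pmf (c l)) (nat \<lfloor>c l\<rfloor>)"
      using c[OF l] m by (intro pmf_poisson_floor_ge) auto
    finally show "exp (- (2 + (ln m + ln W) / 2)) \<le> pmf (poisson_pmf (c l)) (nat \<lfloor>c l\<rfloor>)" .
  qed auto
  also have "\<dots> = pmf (poisson_vec L c) x"
    unfolding poisson_vec_def by (subst pmf_Pi') (auto simp: x_def simp del: pmf_poisson intro!: prod.cong)
  finally have R: "exp (- L * (2 + (ln m + ln W) / 2)) \<le> pmf (poisson_vec L c) x" .
  have "exp (- (real L / 2 * (ln m + (4 + 3 * ln W)))) =
      exp (- L * (2 + (ln m + ln W) / 2)) * exp (- (L * ln W))"
    unfolding exp_add[symmetric] by (simp add: algebra_simps)
  also have "\<dots> \<le> pmf (poisson_vec L c) x * ?w x"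
    by (intro mult_mono R T) auto
  also have "\<dots> = measure_pmf.expectation (poisson_vec L c) (\<lambda>y. indicator {x} y * ?w x)"
    by (simp add: measure_pmf_single)
  also have "\<dots> \<le> measure_pmf.expectation (poisson_vec L c) ?w"
  proof (rule integral_mono)
    show "integrable (measure_pmf (poisson_vec L c)) ?w"
    proof (rule measure_pmf.integrable_const_bound[where B = 1])
      show "AE y in measure_pmf (poisson_vec L c). norm (?w y) \<le> 1"
        using min_exp_le_exp_abs[of 0 s] s by simp
    qed simp
    show "integrable (measure_pmf (poisson_vec L c)) (\<lambda>y. indicator {x} y * ?w x)"
      by (intro integrable_mult_left measure_pmf.integrable_const_bound[where B = 1]) (auto simp: indicator_def)
  qed (auto simp: indicator_def)
  finally have E: "exp (- chernoff_exponent L a b s) * exp (- (real L / 2 * (ln m + (4 + 3 * ln W))))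
    \<le> exp (- chernoff_exponent L a b s) * measure_pmf.expectation (poisson_vec L c) ?w"
    by (intro mult_left_mono) auto
  have err: "lrt_type1 (poisson_vec L a) (poisson_vec L b) + lrt_type2 (poisson_vec L a) (poisson_vec L b) =
      exp (- chernoff_exponent L a b s) * measure_pmf.expectation (poisson_vec L c) ?w"
    unfolding c_def by (rule lrt_error_eq_expectation) (use pos s in auto)
  show ?thesis
    unfolding err using E by (simp add: exp_add[symmetric])
qed

section \<open>The maximiser of the Chernoff exponent\<close>

lemma chernoff_exponent_half:
  assumes "\<And>l. l \<in> {1..L} \<Longrightarrow> 0 < a l" "\<And>l. l \<in> {1..L} \<Longrightarrow> 0 < b l"
  shows "chernoff_exponent L a b (1/2) = (\<Sum>l\<in>{1..L}. (sqrt (b l) - sqrt (a l))\<^sup>2 / 2)"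
  unfolding chernoff_exponent_def
proof (intro sum.cong refl)
  fix l assume "l \<in> {1..L}"
  then show "(1 - 1/2) * a l + 1/2 * b l - tilted_rate (a l) (b l) (1/2) = (sqrt (b l) - sqrt (a l))\<^sup>2 / 2"
    using assms[of l] by (simp add: tilted_rate_def powr_half_sqrt power2_diff field_simps)
qed

text \<open>
  At $s = 1/2$ every summand is half a squared difference of square roots, so a single
  separated coordinate already makes the exponent of order \<open>m\<close>.
\<close>

lemma chernoff_exponent_half_ge:
  fixes m \<delta> :: real
  assumes a: "\<And>l. l \<in> {1..L} \<Longrightarrow> m \<le> a l" and b: "\<And>l. l \<in> {1..L} \<Longrightarrow> m \<le> b l"
    and m: "0 < m" and \<delta>: "0 < \<delta>" and l: "l \<in> {1..L}" "\<delta> \<le> \<bar>ln (b l / a l)\<bar>"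
  shows "m * (exp (\<delta> / 2) - 1)\<^sup>2 / 2 \<le> chernoff_exponent L a b (1/2)"
proof -
  (* Stated for an ordered pair, as either of the two rates may be the larger one. *)
  have gap: "m * (exp (\<delta> / 2) - 1)\<^sup>2 \<le> (sqrt v - sqrt u)\<^sup>2" if "m \<le> u" "0 < v" "\<delta> \<le> ln v - ln u" for u v
  proof -
    have "u * exp \<delta> = exp (ln u + \<delta>)" using that m by (simp add: exp_add)
    also have "\<dots> \<le> exp (ln v)" using that by (subst exp_le_cancel_iff) linarith
    finally have "sqrt (u * exp \<delta>) \<le> sqrt v" using that by simp
    moreover have "sqrt (exp \<delta>) = exp (\<delta> / 2)"
      by (rule real_sqrt_unique) (simp_all add: power2_eq_square exp_add[symmetric])
    ultimately have "sqrt u * (exp (\<delta> / 2) - 1) \<le> sqrt v - sqrt u"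
      by (simp add: real_sqrt_mult algebra_simps)
    moreover have "sqrt m * (exp (\<delta> / 2) - 1) \<le> sqrt u * (exp (\<delta> / 2) - 1)"
      using that \<delta> by (intro mult_right_mono) auto
    ultimately have "sqrt m * (exp (\<delta> / 2) - 1) \<le> sqrt v - sqrt u" by (rule order_trans[rotated])
    then have "(sqrt m * (exp (\<delta> / 2) - 1))\<^sup>2 \<le> (sqrt v - sqrt u)\<^sup>2"
      using m \<delta> by (intro power_mono) auto
    then show ?thesis using m by (simp add: power_mult_distrib)
  qed
  have pos: "\<And>l. l \<in> {1..L} \<Longrightarrow> 0 < a l" "\<And>l. l \<in> {1..L} \<Longrightarrow> 0 < b l"
    using a b m by force+
  have "ln (b l / a l) = ln (b l) - ln (a l)" using pos[OF l(1)] by (simp add: ln_div)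
  then have "m * (exp (\<delta> / 2) - 1)\<^sup>2 \<le> (sqrt (b l) - sqrt (a l))\<^sup>2"
    using gap[of "a l" "b l"] gap[of "b l" "a l"] a[OF l(1)] b[OF l(1)] pos[OF l(1)] l(2)
    by (auto simp: power2_commute abs_if split: if_splits)
  moreover have "(sqrt (b l) - sqrt (a l))\<^sup>2 / 2 \<le> (\<Sum>l\<in>{1..L}. (sqrt (b l) - sqrt (a l))\<^sup>2 / 2)"
    by (rule member_le_sum[of l _ "\<lambda>l. (sqrt (b l) - sqrt (a l))\<^sup>2 / 2"]) (use l in auto)
  moreover have "chernoff_exponent L a b (1/2) = (\<Sum>l\<in>{1..L}. (sqrt (b l) - sqrt (a l))\<^sup>2 / 2)"
    by (rule chernoff_exponent_half) (fact pos)+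
  ultimately show ?thesis by linarith
qed

text \<open>
  Bounding the tilted rate from below by its tangent at $s = 0$ shows that the exponent grows at most
  linearly from its zero at $s = 0$, with a slope of order \<open>m\<close>. Together with the lower bound
  at $s = 1/2$, which is of the same order, this keeps a maximiser away from $0$ and, after exchanging
  the two laws, from $1$.
\<close>

lemma chernoff_exponent_le:
  fixes m W s :: real
  assumes a: "\<And>l. l \<in> {1..L} \<Longrightarrow> a l \<in> {m..W * m}" and b: "\<And>l. l \<in> {1..L} \<Longrightarrow> b l \<in> {m..W * m}"
    and m: "0 < m" and W: "1 \<le> W" and s: "0 \<le> s"
  shows "chernoff_exponent L a b s \<le> s * (L * (W * m * (1 + ln W)))"
proof -
  have "(1 - s) * a l + s * b l - tilted_rate (a l) (b l) s \<le> s * (W * m * (1 + ln W))"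
    if l: "l \<in> {1..L}" for l
  proof -
    have pos: "0 < a l" "0 < b l" using a[OF l] b[OF l] m by auto
    have "ln (a l / b l) \<le> ln W"
    proof (subst ln_le_cancel_iff)
      have "a l \<le> W * m" "W * m \<le> W * b l" using a[OF l] b[OF l] W by auto
      then show "a l / b l \<le> W" using pos by (simp add: field_simps)
    qed (use pos W in auto)
    then have ln: "- ln (b l / a l) \<le> ln W" using pos by (simp add: ln_div)
    have "a l * (1 + s * ln (b l / a l)) \<le> tilted_rate (a l) (b l) s"
      unfolding tilted_rate_eq_exp[OF pos] using pos by (intro mult_left_mono exp_ge_add_one_self) auto
    then have "(1 - s) * a l + s * b l - tilted_rate (a l) (b l) s \<le> s * (b l - a l + a l * (- ln (b l / a l)))"
      by (simp add: algebra_simps)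
    also have "\<dots> \<le> s * (W * m + W * m * ln W)"
    proof (intro mult_left_mono add_mono s)
      have "a l * (- ln (b l / a l)) \<le> a l * ln W" using ln pos by (intro mult_left_mono) auto
      also have "\<dots> \<le> W * m * ln W" using a[OF l] W by (intro mult_right_mono) auto
      finally show "a l * (- ln (b l / a l)) \<le> W * m * ln W" .
    qed (use b[OF l] pos in auto)
    finally show ?thesis by (simp add: algebra_simps)
  qed
  then have "chernoff_exponent L a b s \<le> (\<Sum>l\<in>{1..L}. s * (W * m * (1 + ln W)))"
    unfolding chernoff_exponent_def by (rule sum_mono)
  then show ?thesis by (simp add: algebra_simps)
qed

text \<open>
  The exponent vanishes at $0$ and $1$, so its maximum over $[0, 1]$ is attained in the interior as
  soon as it is positive somewhere. The derivative at the maximiser is minus the mean of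
  the log-likelihood ratio under the intermediate law.
\<close>

lemma chernoff_exponent_maximiser:
  assumes pos: "\<And>l. l \<in> {1..L} \<Longrightarrow> 0 < a l" "\<And>l. l \<in> {1..L} \<Longrightarrow> 0 < b l"
    and half: "0 < chernoff_exponent L a b (1/2)"
  obtains s where "0 < s" "s < 1" "chernoff_info L a b = chernoff_exponent L a b s"
    "chernoff_exponent L a b (1/2) \<le> chernoff_exponent L a b s"
    "(\<Sum>l\<in>{1..L}. a l - b l + tilted_rate (a l) (b l) s * ln (b l / a l)) = 0"
proof -
  define f where "f = chernoff_exponent L a b"
  have f_eq: "f s = (\<Sum>l\<in>{1..L}. (1 - s) * a l + s * b l - a l * exp (s * ln (b l / a l)))" for s
    unfolding f_def chernoff_exponent_def by (intro sum.cong refl) (simp add: tilted_rate_eq_exp pos)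
  have deriv: "(f has_real_derivative
      (\<Sum>l\<in>{1..L}. b l - a l - tilted_rate (a l) (b l) s * ln (b l / a l))) (at s)" for s
  proof -
    have "((\<lambda>s. \<Sum>l\<in>{1..L}. (1 - s) * a l + s * b l - a l * exp (s * ln (b l / a l))) has_real_derivative
      (\<Sum>l\<in>{1..L}. b l - a l - a l * exp (s * ln (b l / a l)) * ln (b l / a l))) (at s)"
      by (auto intro!: derivative_eq_intros sum.cong)
    moreover have "(\<Sum>l\<in>{1..L}. b l - a l - a l * exp (s * ln (b l / a l)) * ln (b l / a l)) =
        (\<Sum>l\<in>{1..L}. b l - a l - tilted_rate (a l) (b l) s * ln (b l / a l))"
      by (intro sum.cong refl) (simp add: tilted_rate_eq_exp pos)
    ultimately show ?thesis unfolding f_eq[abs_def] by simp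
  qed
  have "continuous_on {0..1} f"
    by (intro continuous_at_imp_continuous_on ballI DERIV_isCont[OF deriv])
  then obtain s where s: "s \<in> {0..1}" and max: "\<And>y. y \<in> {0..1} \<Longrightarrow> f y \<le> f s"
    using continuous_attains_sup[of "{0..1::real}" f] by auto
  have "f 0 = 0" unfolding f_eq by simp
  moreover have "f 1 = 0" unfolding f_eq using pos by (force intro!: sum.neutral)
  moreover have "0 < f s" using half max[of "1/2"] by (simp add: f_def)
  ultimately have s01: "0 < s" "s < 1" using s by (auto simp: less_le)
  have "(\<Sum>l\<in>{1..L}. b l - a l - tilted_rate (a l) (b l) s * ln (b l / a l)) = 0"
  proof (rule DERIV_local_max[OF deriv])
    show "0 < min s (1 - s)" using s01 by simp
    show "\<forall>y. \<bar>s - y\<bar> < min s (1 - s) \<longrightarrow> f y \<le> f s" by (intro allI impI max) auto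
  qed
  moreover have "(\<Sum>l\<in>{1..L}. a l - b l + tilted_rate (a l) (b l) s * ln (b l / a l)) =
      - (\<Sum>l\<in>{1..L}. b l - a l - tilted_rate (a l) (b l) s * ln (b l / a l))"
    unfolding sum_negf[symmetric] by (intro sum.cong) auto
  moreover have "chernoff_info L a b = f s"
    unfolding chernoff_info_def tilted_rate_def[symmetric] chernoff_exponent_def[symmetric] f_def[symmetric]
    by (rule cSup_eq_maximum) (use s01 max in auto)
  ultimately show ?thesis using that[of s] s01 max[of "1/2"] by (simp add: f_def)
qed

text \<open>
  All constants depend on \<open>L\<close>, the ratio \<open>W\<close> of the largest to the smallest intensity and the
  separation \<open>\<delta>\<close> only. The number \<open>\<eta>\<close> is the quotient of the lower bound for the exponent
  at $s = 1/2$ by the slope bound at the end points.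
\<close>

lemma lrt_error_bounds:
  fixes L :: nat and a b :: "nat \<Rightarrow> real" and m W \<delta> :: real
  assumes a: "\<And>l. l \<in> {1..L} \<Longrightarrow> a l \<in> {m..W * m}" and b: "\<And>l. l \<in> {1..L} \<Longrightarrow> b l \<in> {m..W * m}"
    and m: "1 \<le> m" and W: "1 \<le> W" and \<delta>: "0 < \<delta>" and l: "l \<in> {1..L}" "\<delta> \<le> \<bar>ln (b l / a l)\<bar>"
  defines "err \<equiv> lrt_type1 (poisson_vec L a) (poisson_vec L b) + lrt_type2 (poisson_vec L a) (poisson_vec L b)"
    and "\<eta> \<equiv> (exp (\<delta> / 2) - 1)\<^sup>2 / (2 * (L * (W * (1 + ln W))))"
  shows "err \<le> 4 / (1 - exp (- (\<eta> * \<delta>))) * exp (- chernoff_info L a b - 1 / 2 * ln m)"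
    and "exp (- chernoff_info L a b - real L / 2 * (ln m + (4 + 3 * ln W))) \<le> err"
proof -
  have pos: "\<And>l. l \<in> {1..L} \<Longrightarrow> 0 < a l" "\<And>l. l \<in> {1..L} \<Longrightarrow> 0 < b l"
    using a b m by force+
  have half: "m * (exp (\<delta> / 2) - 1)\<^sup>2 / 2 \<le> chernoff_exponent L a b (1/2)"
    by (rule chernoff_exponent_half_ge[where l = l]) (use a b m \<delta> l in auto)
  moreover have "0 < m * (exp (\<delta> / 2) - 1)\<^sup>2 / 2" using m \<delta> by simp
  ultimately have "0 < chernoff_exponent L a b (1/2)" by linarith
  from chernoff_exponent_maximiser[of L a b, OF pos this] obtain s where s: "0 < s" "s < 1" "chernoff_info L a b = chernoff_exponent L a b s"
    "chernoff_exponent L a b (1/2) \<le> chernoff_exponent L a b s"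
    "(\<Sum>l\<in>{1..L}. a l - b l + tilted_rate (a l) (b l) s * ln (b l / a l)) = 0" by blast
  have D: "0 < real L * (W * (1 + ln W))" using l(1) W by (intro mult_pos_pos add_pos_nonneg) auto
  (* A linear bound at a distance t from an end point forces t to be at least eta;
     it is used for t = s and, with the two laws exchanged, for t = 1 - s. *)
  have away: "\<eta> \<le> t" if "chernoff_exponent L a b s \<le> t * (L * (W * m * (1 + ln W)))" for t
  proof -
    have "m * ((exp (\<delta> / 2) - 1)\<^sup>2 / 2) \<le> m * (t * (L * (W * (1 + ln W))))"
      using half s(4) that by (simp add: algebra_simps)
    then have "(exp (\<delta> / 2) - 1)\<^sup>2 / 2 \<le> t * (L * (W * (1 + ln W)))"
      by (rule mult_left_le_imp_le) (use m in auto)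
    moreover have "\<eta> = (exp (\<delta> / 2) - 1)\<^sup>2 / 2 / (L * (W * (1 + ln W)))" by (simp add: \<eta>_def)
    ultimately show ?thesis by (simp only: pos_divide_le_eq[OF D])
  qed
  have "\<eta> \<le> s" by (rule away, rule chernoff_exponent_le[OF a b]) (use m W s in auto)
  moreover have "\<eta> \<le> 1 - s"
    by (rule away, subst chernoff_exponent_swap[symmetric], rule chernoff_exponent_le[OF b a]) (use m W s in auto)
  moreover have "0 < \<eta>" unfolding \<eta>_def using D \<delta> by (intro divide_pos_pos) auto
  ultimately have "err \<le> exp (- chernoff_exponent L a b s) * (4 / (1 - exp (- (\<eta> * \<delta>))) / sqrt m)"
    unfolding err_def
    by (intro lrt_error_le[where M = "W * m" and l = l]) (use a b m \<delta> l in auto)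
  moreover have "exp (- chernoff_exponent L a b s) / sqrt m = exp (- chernoff_info L a b - 1 / 2 * ln m)"
    using m by (simp add: s(3) exp_diff ln_sqrt[symmetric])
  then have "exp (- chernoff_exponent L a b s) * (4 / (1 - exp (- (\<eta> * \<delta>))) / sqrt m) =
      4 / (1 - exp (- (\<eta> * \<delta>))) * exp (- chernoff_info L a b - 1 / 2 * ln m)"
    by (metis mult.commute times_divide_eq_left times_divide_eq_right)
  ultimately show "err \<le> 4 / (1 - exp (- (\<eta> * \<delta>))) * exp (- chernoff_info L a b - 1 / 2 * ln m)" by simp
  show "exp (- chernoff_info L a b - real L / 2 * (ln m + (4 + 3 * ln W))) \<le> err"
    unfolding err_def s(3) by (rule lrt_error_ge[OF a b m W _ _ s(5)]) (use s in auto)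
qed

section \<open>The asymptotic statement\<close>

lemma intensities_bounds:
  assumes "l \<in> {1..L}"
  shows "a l \<in> {Lambda_min L a b..Lambda_max L a b}" "b l \<in> {Lambda_min L a b..Lambda_max L a b}"
  using assms by (auto simp: Lambda_min_def Lambda_max_def intensities_def intro!: Min_le Max_ge)

lemma max_rel_dev_witness:
  fixes \<epsilon> :: real
  assumes "L \<ge> 1" "\<And>l. l \<in> {1..L} \<Longrightarrow> 0 < a l" "\<And>l. l \<in> {1..L} \<Longrightarrow> 0 < b l"
    and "0 < \<epsilon>" "\<epsilon> \<le> max_rel_dev L a b"
  obtains l where "l \<in> {1..L}" "ln (1 + \<epsilon>) \<le> \<bar>ln (b l / a l)\<bar>"
proof -
  have "Max ((\<lambda>l. max (a l / b l) (b l / a l)) ` {1..L}) \<in> (\<lambda>l. max (a l / b l) (b l / a l)) ` {1..L}"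
    using assms(1) by (intro Max_in) auto
  then obtain l where l: "l \<in> {1..L}" "max_rel_dev L a b = max (a l / b l) (b l / a l) - 1"
    unfolding max_rel_dev_def by auto
  note pos = assms(2,3)[OF l(1)]
  have "1 + \<epsilon> \<le> a l / b l \<or> 1 + \<epsilon> \<le> b l / a l" using assms(5) l(2) by linarith
  then have "ln (1 + \<epsilon>) \<le> ln (a l / b l) \<or> ln (1 + \<epsilon>) \<le> ln (b l / a l)"
    using assms(4) pos by (auto simp del: ln_div)
  moreover have "ln (a l / b l) = - ln (b l / a l)" using pos by (simp add: ln_div)
  ultimately show ?thesis using that[OF l(1)] by linarith
qed

theorem proposition1:
  fixes L :: nat
    and lamk lamr :: "nat \<Rightarrow> nat \<Rightarrow> real"
    and \<omega> :: "nat \<Rightarrow> real"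
  assumes "L \<ge> 1"
    and "\<And>n l. l \<in> {1..L} \<Longrightarrow> 0 < lamk n l"
    and "\<And>n l. l \<in> {1..L} \<Longrightarrow> 0 < lamr n l"
    and "filterlim (\<lambda>n. Lambda_min L (lamk n) (lamr n)) at_top sequentially"
    and "0 < liminf (\<lambda>n. ereal (max_rel_dev L (lamk n) (lamr n)))"
    and "\<And>n. Lambda_max L (lamk n) (lamr n) / Lambda_min L (lamk n) (lamr n) \<le> \<omega> n"
    and "\<omega> \<in> O(\<lambda>_. 1)"
  shows "\<exists>C C' :: real. \<forall>\<^sub>F n in sequentially.
    (let Qk = poisson_vec L (lamk n);
         Qr = poisson_vec L (lamr n);
         err = lrt_type1 Qk Qr + lrt_type2 Qk Qr;
         I = chernoff_info L (lamk n) (lamr n);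
         m = Lambda_min L (lamk n) (lamr n)
     in err \<le> C * exp (- I - 1 / 2 * ln m) \<and>
        err \<ge> exp (- I - real L / 2 * (ln m + C')))"
proof -
  obtain \<epsilon> :: real where \<epsilon>: "0 < \<epsilon>" "ereal \<epsilon> < liminf (\<lambda>n. ereal (max_rel_dev L (lamk n) (lamr n)))"
    using ereal_dense2[OF assms(5)] by auto
  obtain W0 where W0: "\<forall>\<^sub>F n in sequentially. norm (\<omega> n) \<le> W0 * norm (1 :: real)"
    using landau_o.bigE[OF assms(7)] by blast
  define W where "W = max 1 W0"
  define \<delta> where "\<delta> = ln (1 + \<epsilon>)"
  define \<eta> where "\<eta> = (exp (\<delta> / 2) - 1)\<^sup>2 / (2 * (L * (W * (1 + ln W))))"
  have W: "1 \<le> W" and \<delta>: "0 < \<delta>" using \<epsilon> by (auto simp: W_def \<delta>_def)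
  have "\<forall>\<^sub>F n in sequentially. \<epsilon> < max_rel_dev L (lamk n) (lamr n)"
    using less_LiminfD[OF \<epsilon>(2)] by simp
  moreover have "\<forall>\<^sub>F n in sequentially. 1 \<le> Lambda_min L (lamk n) (lamr n)"
    using assms(4) by (auto simp: filterlim_at_top)
  ultimately have "\<forall>\<^sub>F n in sequentially.
    (let Qk = poisson_vec L (lamk n);
         Qr = poisson_vec L (lamr n);
         err = lrt_type1 Qk Qr + lrt_type2 Qk Qr;
         I = chernoff_info L (lamk n) (lamr n);
         m = Lambda_min L (lamk n) (lamr n)
     in err \<le> (4 / (1 - exp (- (\<eta> * \<delta>)))) * exp (- I - 1 / 2 * ln m) \<and>
        err \<ge> exp (- I - real L / 2 * (ln m + (4 + 3 * ln W))))"
    using W0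
  proof eventually_elim
    case (elim n)
    define m where "m = Lambda_min L (lamk n) (lamr n)"
    have m: "1 \<le> m" using elim by (simp add: m_def)
    have "Lambda_max L (lamk n) (lamr n) / m \<le> W"
      using elim assms(6)[of n] by (simp add: W_def m_def)
    then have "Lambda_max L (lamk n) (lamr n) \<le> W * m" using m by (simp add: field_simps)
    then have range: "lamk n l \<in> {m..W * m}" "lamr n l \<in> {m..W * m}" if "l \<in> {1..L}" for l
      using intensities_bounds(1)[OF that, of "lamk n" "lamr n"]
        intensities_bounds(2)[OF that, of "lamr n" "lamk n"] by (auto simp: m_def)
    obtain l where l: "l \<in> {1..L}" "\<delta> \<le> \<bar>ln (lamr n l / lamk n l)\<bar>"
      unfolding \<delta>_def
      by (rule max_rel_dev_witness[of L "lamk n" "lamr n" \<epsilon>]) (use assms(1-3) \<epsilon>(1) elim(1) in auto)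
    show ?case
      unfolding Let_def m_def[symmetric] \<eta>_def
      by (intro conjI lrt_error_bounds[where l = l]) (use range m W \<delta> l in auto)
  qed
  then show ?thesis by blast
qed

end
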